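(* Let $f$ be a morphism of $\mathrm{Mat}_{\mathbb N}$ and let $f=f_1\otimes\cdots\otimes f_k$ ($k\ge 1$) be its $\otimes$-decomposition into morphisms $f_i$ that are not $\otimes$-decomposable, and let $r_i=\mathrm{rank}(f_i)$. Then \[\max\{r_1,\dots,r_k\}\le\mathrm{mwd}(f)\le\max\{r_1,\dots,r_k\}+1.\]
   Context: $\mathrm{Mat}_{\mathbb N}$ is the prop (strict symmetric monoidal category with objects the natural numbers and $m\otimes n=m+n$) whose morphisms $n\to m$ are $m\times n$ matrices with entries in $\mathbb N$; the composite of $A\colon n\to k$ followed by $B\colon k\to m$ is the product $B\cdot A$, and $A\otimes B=\begin{pmatrix}A&0\\0&B\end{pmatrix}$. A morphism $f$ is $\otimes$-decomposable if there are $f_1,f_2$, both distinct from $f$, with $f=f_1\otimes f_2$. The rank of $A\in\mathrm{Mat}_{\mathbb N}(m,n)$ is $\mathrm{rank}(A)=\min\{k: A=C\cdot B,\ B\in\mathrm{Mat}_{\mathbb N}(k,n),\ C\in\mathrm{Mat}_{\mathbb N}(m,k)\}$. Atoms: $\mathrm{cp}_1=\begin{pmatrix}1\\1\end{pmatrix}\colon1\to2$, $\mathrm{del}_1\colon1\to0$ (the $0\times1$ matrix), $\mathrm{add}_1=(1\ 1)\colon2\to1$, $\mathrm{zero}_1\colon0\to1$ (the $1\times0$ matrix), the symmetry $\sigma_{1,1}=\begin{pmatrix}0&1\\1&0\end{pmatrix}$ and $\mathrm{id}_1=(1)$. Weights: $w(n)=n$ for objects, $w(g)=\max\{m,n\}$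 for an atom $g\colon n\to m$. Monoidal width: monoidal decompositions $D(f)$ of $f\colon a\to b$ are: a leaf $(f)$ if $f$ is an atom; $(d_1\otimes d_2)$ with $d_i\in D(f_i)$ and $f=f_1\otimes f_2$; $(d_1;_jd_2)$ with $d_1\in D(f_1\colon a\to j)$, $d_2\in D(f_2\colon j\to b)$ and $f$ the composite of $f_1$ followed by $f_2$. Width: $\mathrm{wd}((f))=w(f)$, $\mathrm{wd}(d_1\otimes d_2)=\max\{\mathrm{wd}(d_1),\mathrm{wd}(d_2)\}$, $\mathrm{wd}(d_1;_jd_2)=\max\{\mathrm{wd}(d_1),j,\mathrm{wd}(d_2)\}$; $\mathrm{mwd}(f)=\min_{d\in D(f)}\mathrm{wd}(d)$. *)

theory Defs
  imports "Jordan_Normal_Form.Matrix" "HOL-Library.Extended_Nat"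
begin

text \<open>A morphism n \<rightarrow> m of the prop of natural-number matrices is an m \<times> n matrix, so a value A of
  type \<open>nat mat\<close> (whose dimensions may be 0) carries its domain \<open>dim_col A\<close> and its codomain
  \<open>dim_row A\<close>. The composite of A followed by B is \<open>B * A\<close>, meaningful when
  \<open>dim_row A = dim_col B\<close>.\<close>

definition tensor :: "nat mat \<Rightarrow> nat mat \<Rightarrow> nat mat" where
  "tensor A B = four_block_mat A (0\<^sub>m (dim_row A) (dim_col B))
                               (0\<^sub>m (dim_row B) (dim_col A)) B"

lemma diag_block_mat_Cons_tensor:
  "diag_block_mat (A # As) = tensor A (diag_block_mat As)"
  by (simp add: tensor_def Let_def)

lemma diag_block_mat_singleton: "diag_block_mat [A :: nat mat] = A"
  by (rule eq_matI) (auto simp: Let_def)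

definition tensor_decomposable :: "nat mat \<Rightarrow> bool" where
  "tensor_decomposable f \<longleftrightarrow> (\<exists>f1 f2. f1 \<noteq> f \<and> f2 \<noteq> f \<and> f = tensor f1 f2)"

text \<open>The rank over the semiring of natural numbers; the minimum is over a nonempty set, since
  \<open>A = A * 1\<^sub>m (dim_col A)\<close>. It is not the rank over a field.\<close>

definition nat_rank :: "nat mat \<Rightarrow> nat" where
  "nat_rank A = (LEAST k. \<exists>B C. B \<in> carrier_mat k (dim_col A) \<and>
                                C \<in> carrier_mat (dim_row A) k \<and> A = C * B)"

definition cp1 :: "nat mat" where "cp1 = mat_of_rows_list 1 [[1], [1]]"
definition del1 :: "nat mat" where "del1 = 0\<^sub>m 0 1"
definition add1 :: "nat mat" where "add1 = mat_of_rows_list 2 [[1, 1]]"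
definition zero1 :: "nat mat" where "zero1 = 0\<^sub>m 1 0"
definition sigma11 :: "nat mat" where "sigma11 = mat_of_rows_list 2 [[0, 1], [1, 0]]"
definition id1 :: "nat mat" where "id1 = 1\<^sub>m 1"

definition atoms :: "nat mat set" where
  "atoms = {cp1, del1, add1, zero1, sigma11, id1}"

definition weight :: "nat mat \<Rightarrow> nat" where
  "weight g = max (dim_row g) (dim_col g)"

datatype mdecomp =
  Leaf "nat mat"
| Tensor mdecomp mdecomp
| Comp mdecomp nat mdecomp

text \<open>\<open>decomposes d f\<close> means that d is an element of D(f). In \<open>Comp d1 j d2\<close>, d1 decomposes the
  morphism that is applied first.\<close>

inductive decomposes :: "mdecomp \<Rightarrow> nat mat \<Rightarrow> bool" where
  leaf: "f \<in> atoms \<Longrightarrow> decomposes (Leaf f) f"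
| tensor: "decomposes d1 f1 \<Longrightarrow> decomposes d2 f2 \<Longrightarrow>
    decomposes (Tensor d1 d2) (tensor f1 f2)"
| comp: "decomposes d1 f1 \<Longrightarrow> decomposes d2 f2 \<Longrightarrow> dim_row f1 = j \<Longrightarrow> dim_col f2 = j \<Longrightarrow>
    decomposes (Comp d1 j d2) (f2 * f1)"

fun wd :: "mdecomp \<Rightarrow> nat" where
  "wd (Leaf f) = weight f"
| "wd (Tensor d1 d2) = max (wd d1) (wd d2)"
| "wd (Comp d1 j d2) = max (wd d1) (max j (wd d2))"

text \<open>The value is an extended natural number, so that the infimum over an empty set of
  decompositions would be \<open>\<infinity>\<close> rather than 0. An infimum in \<open>enat\<close> over a nonempty set is
  attained, hence a minimum.\<close>

definition mwd :: "nat mat \<Rightarrow> enat" where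
  "mwd f = (INF d \<in> {d. decomposes d f}. enat (wd d))"

end

theory Submission imports Defs begin

text \<open>Lower bound: by induction on a decomposition of \<open>f\<close>, every contiguous block of \<open>f\<close> that is not
  \<open>\<otimes>\<close>-decomposable has rank at most the width.  A composition along \<open>j\<close> factors each block through
  \<open>j\<close>; a block of \<open>f1 \<otimes> f2\<close> is a tensor of a block of \<open>f1\<close> and a block of \<open>f2\<close>, so an indecomposable
  one already lies in \<open>f1\<close> or in \<open>f2\<close>.

  Upper bound: an \<open>r \<times> n\<close> matrix can be evaluated with width \<open>r + 1\<close> by feeding in one input wire at a
  time, letting it pass the \<open>r\<close> accumulators one after the other.  The dual construction handles
  \<open>m \<times> r\<close> matrices, and a rank factorisation composes the two along \<open>r\<close> wires.\<close>

section \<open>Entries of tensors and products\<close>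

lemma dim_tensor [simp]:
  "dim_row (tensor A B) = dim_row A + dim_row B"
  "dim_col (tensor A B) = dim_col A + dim_col B"
  by (simp_all add: tensor_def)

lemma index_tensor:
  "i < dim_row A + dim_row B \<Longrightarrow> j < dim_col A + dim_col B \<Longrightarrow>
   tensor A B $$ (i, j) =
     (if i < dim_row A then if j < dim_col A then A $$ (i, j) else 0
      else if j < dim_col A then 0 else B $$ (i - dim_row A, j - dim_col A))"
  by (auto simp: tensor_def)

declare index_mult_mat(1) [simp del]

lemma index_mult_sum:
  assumes "dim_col A = dim_row B" "i < dim_row A" "j < dim_col B"
  shows "(A * B) $$ (i, j) = (\<Sum>k<dim_row B. A $$ (i, k) * B $$ (k, j))"
  using assms by (simp add: index_mult_mat(1) scalar_prod_def atLeast0LessThan)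

lemma transpose_tensor: "transpose_mat (tensor A B) = tensor (transpose_mat A) (transpose_mat B)"
  by (rule eq_matI) (auto simp: index_tensor)

section \<open>The lower bound\<close>

text \<open>The tensor factors of a composite need not come from tensor factors of its parts,
  whereas a block of a product or of a tensor is again built from blocks. Hence the lower bound is
  proved for all blocks at once.\<close>

definition block :: "nat mat \<Rightarrow> nat \<Rightarrow> nat \<Rightarrow> nat \<Rightarrow> nat \<Rightarrow> nat mat" where
  "block A r c m n = mat m n (\<lambda>(i, j). A $$ (r + i, c + j))"

lemma dim_block [simp]: "dim_row (block A r c m n) = m" "dim_col (block A r c m n) = n"
  by (simp_all add: block_def)

lemma index_block: "i < m \<Longrightarrow> j < n \<Longrightarrow> block A r c m n $$ (i, j) = A $$ (r + i, c + j)"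
  by (simp add: block_def)

lemma nat_rank_mult_le:
  assumes "dim_row B = dim_col C"
  shows "nat_rank (C * B) \<le> dim_row B"
  unfolding nat_rank_def using assms by (intro Least_le) fastforce

lemma nat_rank_le_dim_row: "nat_rank A \<le> dim_row A"
  using nat_rank_mult_le[of A "1\<^sub>m (dim_row A)"] by simp

lemma nat_rank_le_dim_col: "nat_rank A \<le> dim_col A"
  using nat_rank_mult_le[of "1\<^sub>m (dim_col A)" A] by simp

lemma block_mult:
  assumes "dim_row B = dim_col C" "r + m \<le> dim_row C" "c + n \<le> dim_col B"
  shows "block (C * B) r c m n = block C r 0 m (dim_col C) * block B 0 c (dim_row B) n"
  by (rule eq_matI) (use assms in \<open>simp_all add: index_block index_mult_sum\<close>)

text \<open>The first \<open>p\<close> rows and \<open>q\<close> columns of the block fall into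
  \<open>A\<close>. Truncated subtraction covers the other positions: a block starting beyond
  \<open>A\<close> has \<open>p = 0\<close>, one ending inside \<open>A\<close> has
  \<open>m - p = 0\<close>, and likewise for columns.\<close>

lemma block_tensor:
  assumes "r + m \<le> dim_row A + dim_row B" "c + n \<le> dim_col A + dim_col B"
  defines "p \<equiv> min m (dim_row A - r)" and "q \<equiv> min n (dim_col A - c)"
  shows "block (tensor A B) r c m n =
    tensor (block A r c p q) (block B (r + p - dim_row A) (c + q - dim_col A) (m - p) (n - q))"
    (is "_ = ?T")
proof (rule eq_matI)
  have pq: "p \<le> m" "q \<le> n" by (simp_all add: p_def q_def)
  then show "dim_row (block (tensor A B) r c m n) = dim_row ?T"
    "dim_col (block (tensor A B) r c m n) = dim_col ?T" by simp_all
  fix i j assume "i < dim_row ?T" "j < dim_col ?T"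
  with pq have ij: "i < m" "j < n" by simp_all
  have lt: "r + i < dim_row A \<longleftrightarrow> i < p" "c + j < dim_col A \<longleftrightarrow> j < q"
    using ij by (auto simp: p_def q_def)
  \<comment> \<open>As \<open>p \<le> i < m\<close>, the minimum in \<open>p\<close> is
    \<open>dim_row A - r\<close>, so nothing is lost by truncation.\<close>
  have "r + p - dim_row A + (i - p) = r + i - dim_row A" if "p \<le> i"
    using that ij unfolding p_def min_def by (split if_splits) linarith+
  moreover have "c + q - dim_col A + (j - q) = c + j - dim_col A" if "q \<le> j"
    using that ij unfolding q_def min_def by (split if_splits) linarith+
  ultimately show "block (tensor A B) r c m n $$ (i, j) = ?T $$ (i, j)"
    using assms(1,2) pq ij lt by (simp add: index_block index_tensor)
qed

lemma nat_rank_block_le_wd: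
  assumes "decomposes d f" "r + m \<le> dim_row f" "c + n \<le> dim_col f"
    "\<not> tensor_decomposable (block f r c m n)"
  shows "nat_rank (block f r c m n) \<le> wd d"
  using assms
proof (induction arbitrary: r c m n rule: decomposes.induct)
  case (leaf f)
  then show ?case
    using nat_rank_le_dim_row[of "block f r c m n"] by (simp add: weight_def)
next
  case (comp d1 f1 d2 f2 j)
  then show ?case
    \<comment> \<open>Both blocks keep the full inner dimension \<open>j\<close>, so the product has
      rank at most \<open>j\<close>, which \<open>wd\<close> counts.\<close>
    using nat_rank_mult_le[of "block f1 0 c j n" "block f2 r 0 m j"]
    by (simp add: block_mult)
next
  case (tensor d1 f1 d2 f2)
  define p q where "p = min m (dim_row f1 - r)" and "q = min n (dim_col f1 - c)"
  define g1 g2 where "g1 = block f1 r c p q"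
    and "g2 = block f2 (r + p - dim_row f1) (c + q - dim_col f1) (m - p) (n - q)"
  define g where "g = block (Defs.tensor f1 f2) r c m n"
  have split: "g = Defs.tensor g1 g2"
    unfolding g_def g1_def g2_def p_def q_def
    using tensor.prems by (intro block_tensor) auto
  have "nat_rank g \<le> wd d1 \<or> nat_rank g \<le> wd d2"
  \<comment> \<open>Empty blocks are set apart: for \<open>m = 0\<close> the equation
    \<open>m = p\<close> would not place the block inside \<open>f1\<close>.\<close>
  proof (cases "m = 0 \<or> n = 0")
    case True
    then have "nat_rank g = 0"
      using nat_rank_le_dim_row[of g] nat_rank_le_dim_col[of g] by (auto simp: g_def)
    then show ?thesis by simp
  next
    case False
    \<comment> \<open>One factor must be \<open>g\<close> itself; comparing dimensions then shows
      that the block lies entirely in \<open>f1\<close> or entirely beyond it.\<close>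
    from split consider "g1 = g" | "g2 = g"
      using tensor.prems(3) unfolding g_def[symmetric] tensor_decomposable_def by blast
    then show ?thesis
    proof cases
      case 1
      then have "m = p" "n = q"
        by (metis dim_block g1_def g_def)+
      with False have "r + m \<le> dim_row f1" "c + n \<le> dim_col f1"
        unfolding p_def q_def by linarith+
      with tensor.IH(1) tensor.prems(3) show ?thesis
        using 1 \<open>m = p\<close> \<open>n = q\<close> by (metis g1_def g_def)
    next
      case 2
      then have "m - p = m" "n - q = n"
        by (metis dim_block g2_def g_def)+
      moreover from this False tensor.prems(1,2)
      have "r + p - dim_row f1 + m \<le> dim_row f2" "c + q - dim_col f1 + n \<le> dim_col f2"
        unfolding p_def q_def by (auto simp: min_def split: if_splits)
      ultimately show ?thesis
        using tensor.IH(2) tensor.prems(3) 2 by (metis g2_def g_def)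
    qed
  qed
  then show ?case by (auto simp: g_def)
qed

section \<open>The upper bound\<close>

text \<open>Expresses \<open>mwd f \<le> k\<close> by a witness, so that no infimum occurs in the
  constructions.\<close>

definition decomposable_within :: "nat \<Rightarrow> nat mat \<Rightarrow> bool" where
  "decomposable_within k f \<longleftrightarrow> (\<exists>d. decomposes d f \<and> wd d \<le> k)"

lemma decomposable_within_mono:
  "decomposable_within k f \<Longrightarrow> k \<le> l \<Longrightarrow> decomposable_within l f"
  unfolding decomposable_within_def using le_trans by blast

lemma decomposable_within_atom: "f \<in> atoms \<Longrightarrow> weight f \<le> k \<Longrightarrow> decomposable_within k f"
  unfolding decomposable_within_def using decomposes.leaf wd.simps(1) by metis

lemma decomposable_within_tensor:
  assumes "decomposable_within k f" "decomposable_within k g"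
  shows "decomposable_within k (tensor f g)"
proof -
  obtain d e where "decomposes d f" "wd d \<le> k" "decomposes e g" "wd e \<le> k"
    using assms unfolding decomposable_within_def by blast
  then have "decomposes (Tensor d e) (tensor f g)" "wd (Tensor d e) \<le> k"
    by (simp_all add: decomposes.tensor)
  then show ?thesis unfolding decomposable_within_def by blast
qed

lemma decomposable_within_mult:
  assumes "decomposable_within k f" "decomposable_within k g"
    and "dim_row f = dim_col g" "dim_row f \<le> k"
  shows "decomposable_within k (g * f)"
proof -
  obtain d e where "decomposes d f" "wd d \<le> k" "decomposes e g" "wd e \<le> k"
    using assms unfolding decomposable_within_def by blast
  then have "decomposes (Comp d (dim_row f) e) (g * f)" "wd (Comp d (dim_row f) e) \<le> k"
    using assms(3,4) by (simp_all add: decomposes.comp)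
  then show ?thesis unfolding decomposable_within_def by blast
qed

section \<open>The atoms, transposition and identities\<close>

lemmas atom_defs = cp1_def del1_def add1_def zero1_def sigma11_def id1_def

lemma dim_atoms [simp]:
  "dim_row cp1 = 2" "dim_col cp1 = 1" "dim_row del1 = 0" "dim_col del1 = 1"
  "dim_row add1 = 1" "dim_col add1 = 2" "dim_row zero1 = 1" "dim_col zero1 = 0"
  "dim_row sigma11 = 2" "dim_col sigma11 = 2" "dim_row id1 = 1" "dim_col id1 = 1"
  by (simp_all add: atom_defs mat_of_rows_list_def)

lemma index_atoms [simp]:
  "i < 2 \<Longrightarrow> cp1 $$ (i, 0) = 1" "j < 2 \<Longrightarrow> add1 $$ (0, j) = 1" "id1 $$ (0, 0) = 1"
  "i < 2 \<Longrightarrow> j < 2 \<Longrightarrow> sigma11 $$ (i, j) = (if i = j then 0 else 1)"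
  by (auto simp: atom_defs mat_of_rows_list_def less_Suc_eq numeral_2_eq_2)

lemma decomposable_within_atoms:
  "1 \<le> k \<Longrightarrow> decomposable_within k id1" "1 \<le> k \<Longrightarrow> decomposable_within k del1"
  "1 \<le> k \<Longrightarrow> decomposable_within k zero1" "2 \<le> k \<Longrightarrow> decomposable_within k cp1"
  "2 \<le> k \<Longrightarrow> decomposable_within k add1" "2 \<le> k \<Longrightarrow> decomposable_within k sigma11"
  by (rule decomposable_within_atom; simp add: atoms_def weight_def)+

lemma transpose_atoms: "f \<in> atoms \<Longrightarrow> transpose_mat f \<in> atoms"
proof -
  have "transpose_mat cp1 = add1" "transpose_mat add1 = cp1" "transpose_mat del1 = zero1"
    "transpose_mat zero1 = del1" "transpose_mat sigma11 = sigma11" "transpose_mat id1 = id1"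
    by (rule eq_matI; auto simp: atom_defs mat_of_rows_list_def numeral_2_eq_2 less_Suc_eq)+
  then show "f \<in> atoms \<Longrightarrow> transpose_mat f \<in> atoms"
    unfolding atoms_def by auto
qed

text \<open>Transposition permutes the atoms, keeps their weights, respects tensors and reverses
  composites along the same cut. This supplies the dual construction.\<close>

lemma decomposable_within_transpose:
  assumes "decomposable_within k f"
  shows "decomposable_within k (transpose_mat f)"
proof -
  obtain d where "decomposes d f" "wd d \<le> k"
    using assms unfolding decomposable_within_def by blast
  then show ?thesis
  proof (induction rule: decomposes.induct)
    case (leaf f)
    then show ?case
      by (intro decomposable_within_atom transpose_atoms) (auto simp: weight_def)
  next
    case (tensor d1 f1 d2 f2)
    then show ?case by (simp add: transpose_tensor decomposable_within_tensor)
  next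
    case (comp d1 f1 d2 f2 j)
    then have "transpose_mat (f2 * f1) = transpose_mat f1 * transpose_mat f2"
      by (intro transpose_mult) auto
    with comp show ?case by (simp add: decomposable_within_mult)
  qed
qed

lemma decomposable_within_one_mat: "1 \<le> k \<Longrightarrow> decomposable_within k (1\<^sub>m n)"
proof (induction n)
  case 0
  \<comment> \<open>No atom is the empty identity; creating and deleting a wire yields it at width
    1.\<close>
  have "1\<^sub>m 0 = del1 * zero1" by (rule eq_matI) auto
  with 0 show ?case by (simp add: decomposable_within_mult decomposable_within_atoms)
next
  case (Suc n)
  have "1\<^sub>m (Suc n) = tensor id1 (1\<^sub>m n)"
    by (rule eq_matI) (auto simp: index_tensor id1_def)
  with Suc show ?case by (simp add: decomposable_within_tensor decomposable_within_atoms)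
qed

lemma decomposable_within_zero_cols: "1 \<le> k \<Longrightarrow> decomposable_within k (0\<^sub>m n 0)"
proof (induction n)
  case 0
  have "0\<^sub>m 0 0 = (1\<^sub>m 0 :: nat mat)" by (rule eq_matI) auto
  with 0 show ?case by (simp add: decomposable_within_one_mat)
next
  case (Suc n)
  have "0\<^sub>m (Suc n) 0 = tensor zero1 (0\<^sub>m n 0)"
    by (rule eq_matI) auto
  with Suc show ?case by (simp add: decomposable_within_tensor decomposable_within_atoms)
qed

section \<open>Adding one input wire to \<open>r\<close> accumulators\<close>

definition scalar :: "nat \<Rightarrow> nat mat" where
  "scalar a = mat 1 1 (\<lambda>_. a)"

text \<open>The matrix \<open>[I | b]\<close>: the last input is added, with multiplicities \<open>b\<close>, to the other \<open>r\<close>.\<close>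

definition add_col :: "nat \<Rightarrow> (nat \<Rightarrow> nat) \<Rightarrow> nat mat" where
  "add_col r b = mat r (Suc r) (\<lambda>(i, j). if j < r then if i = j then 1 else 0 else b i)"

text \<open>Sends \<open>(x, y)\<close> to \<open>(y, x + a y)\<close>: the new wire
  \<open>y\<close> adds itself \<open>a\<close> times to the accumulator \<open>x\<close> and moves
  in front of it.\<close>

definition swap_add :: "nat \<Rightarrow> nat mat" where
  "swap_add a = mat 2 2 (\<lambda>(i, j). if i = 0 then j else if j = 0 then 1 else a)"

lemma dim_aux [simp]:
  "dim_row (scalar a) = 1" "dim_col (scalar a) = 1"
  "dim_row (add_col r b) = r" "dim_col (add_col r b) = Suc r"
  "dim_row (swap_add a) = 2" "dim_col (swap_add a) = 2"
  by (simp_all add: scalar_def add_col_def swap_add_def)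

lemma index_aux [simp]:
  "scalar a $$ (0, 0) = a"
  "i < r \<Longrightarrow> j < Suc r \<Longrightarrow>
    add_col r b $$ (i, j) = (if j < r then if i = j then 1 else 0 else b i)"
  "i < 2 \<Longrightarrow> j < 2 \<Longrightarrow> swap_add a $$ (i, j) = (if i = 0 then j else if j = 0 then 1 else a)"
  by (simp_all add: scalar_def add_col_def swap_add_def)

text \<open>Copy the wire, multiply one copy by \<open>a\<close>, add the two.\<close>

lemma scalar_Suc: "scalar (Suc a) = add1 * (tensor id1 (scalar a) * cp1)"
  by (rule eq_matI) (simp_all add: index_mult_sum index_tensor numeral_eq_Suc)

lemma decomposable_within_scalar: "decomposable_within 2 (scalar a)"
proof (induction a)
  case 0
  have "scalar 0 = zero1 * del1"
    by (rule eq_matI) (simp_all add: index_mult_sum)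
  then show ?case by (simp add: decomposable_within_mult decomposable_within_atoms)
next
  case (Suc a)
  then show ?case unfolding scalar_Suc
    by (intro decomposable_within_mult decomposable_within_tensor decomposable_within_atoms) auto
qed

lemma add_col_1: "add_col (Suc 0) b = add1 * tensor id1 (scalar (b 0))"
  by (rule eq_matI) (auto simp: index_mult_sum index_tensor numeral_eq_Suc less_Suc_eq)

lemma decomposable_within_add_col_1: "decomposable_within 2 (add_col (Suc 0) b)"
  unfolding add_col_1
  by (intro decomposable_within_mult decomposable_within_tensor decomposable_within_atoms
      decomposable_within_scalar) auto

text \<open>The wires become \<open>(x, y, y)\<close>, then \<open>(y, x, y)\<close>, then
  \<open>(y, x + a y)\<close>; the copy of \<open>y\<close> is the third wire.\<close>

lemma swap_add_eq:
  "swap_add a = tensor id1 (add_col (Suc 0) (\<lambda>_. a)) * (tensor sigma11 id1 * tensor id1 cp1)"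
  by (rule eq_matI) (auto simp: index_mult_sum index_tensor numeral_eq_Suc less_Suc_eq)

lemma decomposable_within_swap_add: "decomposable_within 3 (swap_add a)"
  unfolding swap_add_eq
  by (intro decomposable_within_mult decomposable_within_tensor decomposable_within_atoms
      decomposable_within_mono[OF decomposable_within_add_col_1]) auto

lemma sum_mult_delta:
  fixes f :: "nat \<Rightarrow> nat"
  assumes "\<And>k. k < r \<Longrightarrow> g k = (if k = j then 1 else 0)"
  shows "(\<Sum>k<r. f k * g k) = (if j < r then f j else 0)"
proof -
  have "(\<Sum>k<r. f k * g k) = (\<Sum>k<r. if k = j then f k else 0)"
    using assms by (intro sum.cong) auto
  then show ?thesis by simp
qed

text \<open>The new wire first passes the last accumulator, which is then complete and waits on
  \<open>id1\<close>, while the wire goes on to the first \<open>r\<close> accumulators.\<close>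

lemma add_col_Suc: "add_col (Suc r) b = tensor (add_col r b) id1 * tensor (1\<^sub>m r) (swap_add (b r))"
  (is "?L = ?A * ?B")
proof (rule eq_matI)
  fix i j assume "i < dim_row (?A * ?B)" "j < dim_col (?A * ?B)"
  then have ij: "i < Suc r" "j < Suc (Suc r)" by simp_all
  \<comment> \<open>The first \<open>r\<close> rows of \<open>?B\<close> are unit rows; only the
    inner wires \<open>r\<close> and \<open>Suc r\<close>, where \<open>swap_add\<close> acts,
    remain.\<close>
  have "(\<Sum>k<r. ?A $$ (i, k) * ?B $$ (k, j)) = (if j < r then ?A $$ (i, j) else 0)"
    using ij by (intro sum_mult_delta) (auto simp: index_tensor)
  then have "(?A * ?B) $$ (i, j) = (if j < r then ?A $$ (i, j) else 0) +
      ?A $$ (i, r) * ?B $$ (r, j) + ?A $$ (i, Suc r) * ?B $$ (Suc r, j)"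
    using ij by (simp add: index_mult_sum)
  also have "\<dots> = ?L $$ (i, j)"
    using ij by (cases "i = r"; cases "j = r"; cases "j = Suc r") (auto simp: index_tensor)
  finally show "?L $$ (i, j) = (?A * ?B) $$ (i, j)" ..
qed auto

text \<open>A single accumulator is treated separately, as \<open>swap_add\<close> needs three wires.\<close>

lemma decomposable_within_add_col: "decomposable_within (Suc r) (add_col r b)"
proof (induction r)
  case 0
  have "add_col 0 b = del1" by (rule eq_matI) auto
  then show ?case by (simp add: decomposable_within_atoms)
next
  case (Suc r)
  show ?case
  proof (cases "r = 0")
    case True
    then show ?thesis using decomposable_within_add_col_1 by (simp add: numeral_2_eq_2)
  next
    case False
    then show ?thesis unfolding add_col_Suc
      by (intro decomposable_within_mult decomposable_within_tensor decomposable_within_atoms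
          decomposable_within_one_mat decomposable_within_mono[OF Suc.IH]
          decomposable_within_mono[OF decomposable_within_swap_add]) auto
  qed
qed

section \<open>Arbitrary matrices column by column, and rank factorisations\<close>

lemma mat_snoc_col:
  assumes "A \<in> carrier_mat r (Suc n)"
  shows "A = add_col r (\<lambda>i. A $$ (i, n)) * tensor (block A 0 0 r n) id1" (is "_ = ?C * ?B")
proof (rule eq_matI)
  fix i j assume "i < dim_row (?C * ?B)" "j < dim_col (?C * ?B)"
  then have ij: "i < r" "j < Suc n" by simp_all
  have "(\<Sum>k<r. ?B $$ (k, j) * ?C $$ (i, k)) = (if i < r then ?B $$ (i, j) else 0)"
    using ij by (intro sum_mult_delta) auto
  then have "(?C * ?B) $$ (i, j) = ?B $$ (i, j) + ?C $$ (i, r) * ?B $$ (r, j)"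
    using ij by (simp add: index_mult_sum mult.commute)
  also have "\<dots> = A $$ (i, j)"
    using ij by (cases "j = n") (auto simp: index_tensor index_block)
  finally show "A $$ (i, j) = (?C * ?B) $$ (i, j)" ..
qed (use assms in auto)

text \<open>The last input waits on \<open>id1\<close> beside the matrix of the other columns. A
  tensor has the maximum of the widths, so waiting is free, and each cut has only the accumulators
  and one input: \<open>Suc (dim_row A)\<close> wires, whatever the number of columns.\<close>

lemma decomposable_within_Suc_dim_row: "decomposable_within (Suc (dim_row A)) A"
proof (induction "dim_col A" arbitrary: A)
  case 0
  then have "A = 0\<^sub>m (dim_row A) 0" by (intro eq_matI) auto
  then show ?case by (metis decomposable_within_zero_cols le_add1 plus_1_eq_Suc)
next
  case (Suc n)
  have "A = add_col (dim_row A) (\<lambda>i. A $$ (i, n)) * tensor (block A 0 0 (dim_row A) n) id1"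
    using Suc.hyps(2) by (intro mat_snoc_col) auto
  moreover have "decomposable_within (Suc (dim_row A)) \<dots>"
    using Suc.hyps(1)[of "block A 0 0 (dim_row A) n"]
    by (intro decomposable_within_mult decomposable_within_tensor decomposable_within_atoms
        decomposable_within_add_col) auto
  ultimately show ?case by simp
qed

lemma nat_rank_factorization:
  obtains B C where "B \<in> carrier_mat (nat_rank A) (dim_col A)"
    "C \<in> carrier_mat (dim_row A) (nat_rank A)" "A = C * B"
proof -
  have "\<exists>B C. B \<in> carrier_mat (dim_col A) (dim_col A) \<and>
      C \<in> carrier_mat (dim_row A) (dim_col A) \<and> A = C * B"
    by (intro exI[of _ "1\<^sub>m (dim_col A)"] exI[of _ A]) auto
  from LeastI[of "\<lambda>k. \<exists>B C. B \<in> carrier_mat k (dim_col A) \<and>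
      C \<in> carrier_mat (dim_row A) k \<and> A = C * B", OF this] that
  show thesis unfolding nat_rank_def by blast
qed

lemma decomposable_within_Suc_nat_rank: "decomposable_within (Suc (nat_rank A)) A"
proof -
  obtain B C where BC: "B \<in> carrier_mat (nat_rank A) (dim_col A)"
    "C \<in> carrier_mat (dim_row A) (nat_rank A)" "A = C * B"
    by (rule nat_rank_factorization)
  have "decomposable_within (Suc (nat_rank A)) B"
    using decomposable_within_Suc_dim_row[of B] BC(1) by simp
  \<comment> \<open>\<open>transpose_mat C\<close> has \<open>nat_rank A\<close> rows, and
    transposing twice gives back \<open>C\<close>.\<close>
  moreover have "decomposable_within (Suc (nat_rank A)) C"
    using decomposable_within_transpose[OF decomposable_within_Suc_dim_row[of "transpose_mat C"]]
      BC(2) by simp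
  ultimately show ?thesis
    using BC decomposable_within_mult[of "Suc (nat_rank A)" B C] by simp
qed

text \<open>The induction starts at one-element lists: the empty list gives the empty matrix, which
  has no decomposition of width 0.\<close>

lemma decomposable_within_diag_block_mat:
  assumes "fs \<noteq> []" "\<forall>g \<in> set fs. decomposable_within k g"
  shows "decomposable_within k (diag_block_mat fs)"
  using assms
proof (induction fs rule: list_nonempty_induct)
  case (single g)
  then show ?case by (simp only: diag_block_mat_singleton list.set_intros)
next
  case (cons g fs)
  then show ?case unfolding diag_block_mat_Cons_tensor
    by (intro decomposable_within_tensor) auto
qed

section \<open>Both bounds\<close>

text \<open>The offsets are the total numbers of rows and columns of the members before
  \<open>g\<close>. This makes the bound on blocks applicable to the tensor factors.\<close>

lemma diag_block_mat_block:
  assumes "g \<in> set fs"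
  shows "\<exists>r c. r + dim_row g \<le> dim_row (diag_block_mat fs) \<and>
    c + dim_col g \<le> dim_col (diag_block_mat fs) \<and>
    g = block (diag_block_mat fs) r c (dim_row g) (dim_col g)"
  using assms
proof (induction fs)
  case (Cons h fs)
  show ?case
  proof (cases "g = h")
    case True
    have "g = block (tensor h (diag_block_mat fs)) 0 0 (dim_row g) (dim_col g)"
      by (rule eq_matI) (auto simp: True index_block index_tensor)
    then show ?thesis unfolding diag_block_mat_Cons_tensor
      by (intro exI[of _ 0]) (auto simp: True)
  next
    case False
    with Cons obtain r c where rc: "r + dim_row g \<le> dim_row (diag_block_mat fs)"
      "c + dim_col g \<le> dim_col (diag_block_mat fs)"
      "g = block (diag_block_mat fs) r c (dim_row g) (dim_col g)" by auto
    have "block (diag_block_mat fs) r c (dim_row g) (dim_col g) =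
        block (tensor h (diag_block_mat fs)) (dim_row h + r) (dim_col h + c) (dim_row g) (dim_col g)"
      by (rule eq_matI) (use rc(1,2) in \<open>auto simp: index_block index_tensor add.assoc\<close>)
    with rc show ?thesis unfolding diag_block_mat_Cons_tensor
      by (intro exI[of _ "dim_row h + r"] exI[of _ "dim_col h + c"]) auto
  qed
qed simp

theorem theorem4p13:
  fixes f :: "nat mat" and fs :: "nat mat list"
  assumes "fs \<noteq> []"
    and "f = diag_block_mat fs"
    and "\<forall>g \<in> set fs. \<not> tensor_decomposable g"
  shows "enat (Max (nat_rank ` set fs)) \<le> mwd f \<and>
         mwd f \<le> enat (Max (nat_rank ` set fs) + 1)"
proof
  show "enat (Max (nat_rank ` set fs)) \<le> mwd f"
    unfolding mwd_def
  proof (rule INF_greatest)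
    fix d assume d: "d \<in> {d. decomposes d f}"
    have "nat_rank g \<le> wd d" if g: "g \<in> set fs" for g
    proof -
      obtain r c where "r + dim_row g \<le> dim_row f" "c + dim_col g \<le> dim_col f"
        "g = block f r c (dim_row g) (dim_col g)"
        using diag_block_mat_block[OF g] assms(2) by auto
      then show ?thesis
        using nat_rank_block_le_wd[of d f r "dim_row g" c "dim_col g"] d g assms(3) by auto
    qed
    then show "enat (Max (nat_rank ` set fs)) \<le> enat (wd d)"
      using assms(1) by simp
  qed
next
  \<comment> \<open>Each factor fits into its own rank plus 1, and tensoring the factors only takes
    the maximum.\<close>
  have "decomposable_within (Max (nat_rank ` set fs) + 1) f"
    unfolding assms(2)
    by (intro decomposable_within_diag_block_mat assms(1) ballI
        decomposable_within_mono[OF decomposable_within_Suc_nat_rank]) simp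
  then obtain d where "decomposes d f" "wd d \<le> Max (nat_rank ` set fs) + 1"
    unfolding decomposable_within_def by blast
  then show "mwd f \<le> enat (Max (nat_rank ` set fs) + 1)"
    unfolding mwd_def by (intro INF_lower2[of d]) auto
qed

end
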